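(* Let $N_1,\ldots,N_k\in\mathbb{Z}$ be pairwise coprime with $N_j\le-2$ for all $j$. If $(x-N_1)\cdots(x-N_k)$ is a CNS polynomial, then every integer $a$ has a finite simultaneous expansion $$a=\sum_{i=0}^{\ell}d_iN_j^i\qquad(j=1,\ldots,k)$$ with digits $d_i\in\{0,1,\ldots,|N_1\cdots N_k|-1\}$ that are the same for all $j$. In particular, this conclusion always holds if $k\le4$.
   Context: A monic $f\in\mathbb{Z}[x]$ is a CNS polynomial if every element of $\mathbb{Z}[x]/(f)$ can be written as $\sum_{i=0}^\ell d_iX^i$ with $X$ the residue class of $x$ and $d_i\in\{0,1,\ldots,|f(0)|-1\}$. *)

theory Defs
  imports "HOL-Algebra.Algebraic_Closure_Type"
begin

abbreviation ZX :: "int poly ring" where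
  "ZX \<equiv> ring_of_type_algebra"

definition residue_class :: "int poly \<Rightarrow> int poly \<Rightarrow> int poly set" where
  "residue_class f g = PIdl\<^bsub>ZX\<^esub> f +>\<^bsub>ZX\<^esub> g"

definition ZX_mod :: "int poly \<Rightarrow> int poly set ring" where
  "ZX_mod f = ZX Quot (PIdl\<^bsub>ZX\<^esub> f)"

text \<open>The sum, the powers and the integer multiples \<open>[d i] \<cdot> _\<close> are those of the quotient ring.\<close>

definition CNS_polynomial :: "int poly \<Rightarrow> bool" where
  "CNS_polynomial f \<longleftrightarrow>
     lead_coeff f = 1 \<and>
     (\<forall>\<alpha>\<in>carrier (ZX_mod f). \<exists>(l::nat) (d :: nat \<Rightarrow> int).
        (\<forall>i\<le>l. d i \<in> {0..\<bar>poly f 0\<bar> - 1}) \<and>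
        \<alpha> = (\<Oplus>\<^bsub>ZX_mod f\<^esub>i\<in>{..l}.
               [d i] \<cdot>\<^bsub>ZX_mod f\<^esub> (residue_class f [:0, 1:] [^]\<^bsub>ZX_mod f\<^esub> i)))"

text \<open>A single digit sequence \<open>d\<close> has to serve all the bases.\<close>

definition has_simultaneous_expansion :: "nat \<Rightarrow> (nat \<Rightarrow> int) \<Rightarrow> int \<Rightarrow> bool" where
  "has_simultaneous_expansion k N a \<longleftrightarrow>
     (\<exists>(l::nat) (d :: nat \<Rightarrow> int).
        (\<forall>i\<le>l. d i \<in> {0..\<bar>\<Prod>j=1..k. N j\<bar> - 1}) \<and>
        (\<forall>j\<in>{1..k}. a = (\<Sum>i\<le>l. d i * N j ^ i)))"

lemma ZX_simps:
  "carrier ZX = UNIV" "x \<otimes>\<^bsub>ZX\<^esub> y = x * y" "x \<oplus>\<^bsub>ZX\<^esub> y = x + y" "\<one>\<^bsub>ZX\<^esub> = 1" "\<zero>\<^bsub>ZX\<^esub> = 0"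
  by (simp_all add: ring_of_type_algebra_def)

lemma cring_ZX: "cring ZX"
  by (rule cring_from_type_algebra)

lemma PIdl_ZX: "PIdl\<^bsub>ZX\<^esub> f = {g. f dvd g}"
  by (auto simp: cgenideal_def ZX_simps dvd_def mult.commute)

lemma ideal_PIdl_ZX: "ideal (PIdl\<^bsub>ZX\<^esub> f) ZX"
  using cring.cgenideal_ideal[OF cring_ZX, of f] by (simp add: ZX_simps)

lemma a_minus_ZX: "x \<ominus>\<^bsub>ZX\<^esub> y = x - y"
proof -
  interpret cring ZX by (rule cring_ZX)
  have "\<ominus>\<^bsub>ZX\<^esub> y = - y"
    using minus_equality[of "- y" y] by (simp add: ZX_simps)
  thus ?thesis by (simp add: a_minus_def ZX_simps)
qed

lemma residue_class_eq_iff: "residue_class f g = residue_class f h \<longleftrightarrow> f dvd g - h"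
proof -
  interpret cring ZX by (rule cring_ZX)
  have "f dvd g - h \<longleftrightarrow> g \<ominus>\<^bsub>ZX\<^esub> h \<in> PIdl\<^bsub>ZX\<^esub> f"
    by (simp add: PIdl_ZX a_minus_ZX)
  also have "\<dots> \<longleftrightarrow> residue_class f g = residue_class f h"
    unfolding residue_class_def
    using quotient_eq_iff_same_a_r_cos[OF ideal_PIdl_ZX, of g h f] by (simp add: ZX_simps)
  finally show ?thesis by blast
qed

lemma carrier_ZX_mod: "carrier (ZX_mod f) = range (residue_class f)"
  by (auto simp: ZX_mod_def residue_class_def FactRing_def A_RCOSETS_def' ZX_simps)

lemma ring_hom_cring_residue_class: "ring_hom_cring ZX (ZX_mod f) (residue_class f)"
proof -
  have "residue_class f = (+>\<^bsub>ZX\<^esub>) (PIdl\<^bsub>ZX\<^esub> f)"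
    by (simp add: fun_eq_iff residue_class_def)
  thus ?thesis
    using ideal.rcos_ring_hom_cring[OF ideal_PIdl_ZX cring_ZX] by (simp add: ZX_mod_def)
qed

lemma sum_ZX_mod:
  assumes "\<And>i. i \<le> l \<Longrightarrow> 0 \<le> d i"
  shows "(\<Oplus>\<^bsub>ZX_mod f\<^esub>i\<in>{..l}.
            [d i] \<cdot>\<^bsub>ZX_mod f\<^esub> (residue_class f [:0, 1:] [^]\<^bsub>ZX_mod f\<^esub> i)) =
         residue_class f (\<Sum>i\<le>l. Polynomial.monom (d i) i)"
proof -
  interpret h: ring_hom_cring ZX "ZX_mod f" "residue_class f"
    by (rule ring_hom_cring_residue_class)
  have pow: "g [^]\<^bsub>ZX\<^esub> n = g ^ n" for g and n :: nat
    by (induction n) (simp_all add: ZX_simps mult.commute)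
  have smul: "[n] \<cdot>\<^bsub>ZX_mod f\<^esub> residue_class f g = residue_class f (of_nat n * g)" for n :: nat and g
  proof (induction n)
    case 0
    show ?case using h.hom_zero by (simp add: ZX_simps)
  next
    case (Suc n)
    have "residue_class f (of_nat (Suc n) * g) = residue_class f (of_nat n * g \<oplus>\<^bsub>ZX\<^esub> g)"
      by (simp add: ZX_simps algebra_simps)
    also have "\<dots> = residue_class f (of_nat n * g) \<oplus>\<^bsub>ZX_mod f\<^esub> residue_class f g"
      by (rule h.hom_add) (simp_all add: ZX_simps)
    finally show ?case using Suc by simp
  qed
  have "[d i] \<cdot>\<^bsub>ZX_mod f\<^esub> (residue_class f [:0, 1:] [^]\<^bsub>ZX_mod f\<^esub> i) =
        residue_class f (Polynomial.monom (d i) i)" if "i \<le> l" for i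
  proof -
    have "residue_class f [:0, 1:] [^]\<^bsub>ZX_mod f\<^esub> i = residue_class f ([:0, 1:] ^ i)"
      using h.hom_pow[of "[:0, 1:]" i] by (simp add: pow ZX_simps)
    moreover have "of_nat (nat (d i)) * [:0, 1:] ^ i = Polynomial.monom (d i) i"
      using assms[OF that] by (simp add: monom_altdef of_nat_poly)
    ultimately show ?thesis
      using assms[OF that] by (simp add: add_pow_int_ge smul)
  qed
  hence "(\<Oplus>\<^bsub>ZX_mod f\<^esub>i\<in>{..l}.
            [d i] \<cdot>\<^bsub>ZX_mod f\<^esub> (residue_class f [:0, 1:] [^]\<^bsub>ZX_mod f\<^esub> i)) =
         (\<Oplus>\<^bsub>ZX_mod f\<^esub>i\<in>{..l}. residue_class f (Polynomial.monom (d i) i))"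
    by (intro h.S.finsum_cong') (auto simp: carrier_ZX_mod)
  also have "\<dots> = residue_class f (\<Sum>i\<le>l. Polynomial.monom (d i) i)"
  proof -
    have "(\<Oplus>\<^bsub>ZX\<^esub>i\<in>{..l}. Polynomial.monom (d i) i) = (\<Sum>i\<le>l. Polynomial.monom (d i) i)"
      by (induction l) (simp_all add: ZX_simps atMost_Suc add.commute)
    thus ?thesis
      using h.hom_finsum[of "\<lambda>i. Polynomial.monom (d i) i" "{..l}"]
      by (simp add: ZX_simps comp_def)
  qed
  finally show ?thesis .
qed

lemma CNS_polynomial_iff_dvd:
  "CNS_polynomial f \<longleftrightarrow>
     lead_coeff f = 1 \<and>
     (\<forall>g. \<exists>(l::nat) (d :: nat \<Rightarrow> int).
        (\<forall>i\<le>l. d i \<in> {0..\<bar>poly f 0\<bar> - 1}) \<and> f dvd g - (\<Sum>i\<le>l. Polynomial.monom (d i) i))"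
proof -
  have "(\<forall>i\<le>l. d i \<in> {0..\<bar>poly f 0\<bar> - 1}) \<and>
        residue_class f g = (\<Oplus>\<^bsub>ZX_mod f\<^esub>i\<in>{..l}.
           [d i] \<cdot>\<^bsub>ZX_mod f\<^esub> (residue_class f [:0, 1:] [^]\<^bsub>ZX_mod f\<^esub> i)) \<longleftrightarrow>
        (\<forall>i\<le>l. d i \<in> {0..\<bar>poly f 0\<bar> - 1}) \<and> f dvd g - (\<Sum>i\<le>l. Polynomial.monom (d i) i)"
    for g l d
    by (rule conj_cong[OF refl], subst sum_ZX_mod) (auto simp: residue_class_eq_iff)
  thus ?thesis
    unfolding CNS_polynomial_def carrier_ZX_mod by simp
qed

end

theory Submission
  imports Defs
begin

text \<open>
  An expansion of \<open>a\<close> modulo \<open>f\<close> is a polynomial \<open>a + Q * f\<close> all of whose coefficients are digits;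
  evaluating it at the roots of \<open>f\<close> gives the simultaneous expansions. The coefficients of \<open>Q\<close> are
  forced one after the other, each by the preceding \<open>deg f\<close> ones, so the point is that this
  recursion dies out. By Brunotte's argument it suffices to check this on a set of states which
  contains the unit vectors and is closed under the carries caused by adding two states.

  For \<open>f = (x + m\<^sub>1) ... (x + m\<^sub>k)\<close> with \<open>1/m\<^sub>1 + ... + 1/m\<^sub>k < 1\<close> the coefficients of \<open>f\<close> decrease,
  and the states with alternating entries \<open>1\<close>, \<open>-1\<close> (ignoring zeros) form such a set. For \<open>k \<le> 4\<close> and
  pairwise coprime \<open>m\<^sub>i\<close> the only other possibilities are \<open>{2, 3, 5}\<close> and some \<open>{2, 3, x, y}\<close>. Their
  coefficient vectors lie in a polyhedral cone with four rays, and a single set of 63 states works for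
  the whole cone.
\<close>

section \<open>Digit polynomials for integers\<close>

definition expands_integers :: "int poly \<Rightarrow> bool" where
  "expands_integers f \<longleftrightarrow> (\<forall>a. \<exists>D. (\<forall>i. coeff D i \<in> {0..\<bar>poly f 0\<bar> - 1}) \<and> f dvd [:a:] - D)"

lemma CNS_imp_expands_integers:
  assumes "CNS_polynomial f" "poly f 0 \<noteq> 0"
  shows "expands_integers f"
  unfolding expands_integers_def
proof
  fix a
  obtain l d where ld: "\<forall>i\<le>l. d i \<in> {0..\<bar>poly f 0\<bar> - 1}"
    "f dvd [:a:] - (\<Sum>i\<le>l. Polynomial.monom (d i) i)"
    using assms(1) unfolding CNS_polynomial_iff_dvd by blast
  \<comment> \<open>Positions beyond \<open>l\<close> receive the digit 0, which is admissible
    because \<open>poly f 0\<close> is nonzero.\<close>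
  have "coeff (\<Sum>i\<le>l. Polynomial.monom (d i) i) j = (if j \<le> l then d j else 0)" for j :: nat
    by (simp add: coeff_sum coeff_monom)
  then have "\<forall>j. coeff (\<Sum>i\<le>l. Polynomial.monom (d i) i) j \<in> {0..\<bar>poly f 0\<bar> - 1}"
    using ld(1) assms(2) by simp
  then show "\<exists>D. (\<forall>i. coeff D i \<in> {0..\<bar>poly f 0\<bar> - 1}) \<and> f dvd [:a:] - D"
    using ld(2) by blast
qed

lemma expands_integers_imp_expansion:
  assumes "expands_integers (\<Prod>j=1..k. [:- N j, 1:])"
  shows "has_simultaneous_expansion k N a"
proof -
  let ?f = "\<Prod>j=1..k. [:- N j, 1:]"
  have f0: "\<bar>poly ?f 0\<bar> = \<bar>\<Prod>j=1..k. N j\<bar>"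
    by (simp add: poly_prod abs_prod)
  obtain D where D: "\<And>i. coeff D i \<in> {0..\<bar>poly ?f 0\<bar> - 1}" "?f dvd [:a:] - D"
    using assms unfolding expands_integers_def by blast
  have "a = (\<Sum>i\<le>degree D. coeff D i * N j ^ i)" if "j \<in> {1..k}" for j
  proof -
    have "[:- N j, 1:] dvd ?f"
      using that by (intro dvd_prodI) auto
    then have "[:- N j, 1:] dvd [:a:] - D"
      using D(2) by (rule dvd_trans)
    then have "poly ([:a:] - D) (N j) = 0"
      by (simp only: poly_eq_0_iff_dvd)
    then show ?thesis by (simp add: poly_altdef[of D])
  qed
  then show ?thesis
    unfolding has_simultaneous_expansion_def using D(1) f0 by metis
qed

section \<open>The carry recursion\<close>

text \<open>A state \<open>z\<close> lists the previous coefficients of the quotient \<open>Q\<close>, latest first; only \<open>z 0, ..., z (n - 1)\<close>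
  matter. Any \<open>n \<ge> degree f\<close> is allowed, so that a cubic can be treated as a degenerate quartic.\<close>

definition carry_sum :: "int poly \<Rightarrow> nat \<Rightarrow> (nat \<Rightarrow> int) \<Rightarrow> int" where
  "carry_sum f n z = (\<Sum>i<n. coeff f (Suc i) * z i)"

text \<open>The digit emitted by a step is \<open>coeff f 0 * q + carry_sum f n z\<close>; its range
  forces \<open>q = - (carry_sum f n z div coeff f 0)\<close>. Being inductive, the predicate says
  that this deterministic orbit reaches the zero state.\<close>

inductive terminates :: "int poly \<Rightarrow> nat \<Rightarrow> (nat \<Rightarrow> int) \<Rightarrow> bool" for f n where
  halt: "(\<And>i. i < n \<Longrightarrow> z i = 0) \<Longrightarrow> terminates f n z"
| step: "\<lbrakk>0 \<le> coeff f 0 * q + carry_sum f n z; coeff f 0 * q + carry_sum f n z < coeff f 0;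
          terminates f n (case_nat q z)\<rbrakk> \<Longrightarrow> terminates f n z"

text \<open>The part of \<open>Q * f\<close> not yet turned into digits: the multiple of
  \<open>f\<close> by \<open>z i\<close> entered \<open>i + 1\<close> positions ago and has since
  lost its \<open>i + 1\<close> lowest coefficients.\<close>

definition remainder_poly :: "int poly \<Rightarrow> nat \<Rightarrow> (nat \<Rightarrow> int) \<Rightarrow> int poly" where
  "remainder_poly f n z = (\<Sum>i<n. smult (z i) (poly_shift (Suc i) f))"

lemma poly_shift_unfold: "poly_shift i f = pCons (coeff f i) (poly_shift (Suc i) f)"
  by (rule poly_eqI) (auto simp: coeff_poly_shift coeff_pCons split: nat.splits)

lemma pCons_0_sum: "pCons 0 (sum g A) = (\<Sum>i\<in>A. pCons 0 (g i))" for g :: "'i \<Rightarrow> 'a::comm_ring_1 poly"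
proof -
  have "[:0, 1:] * sum g A = (\<Sum>i\<in>A. [:0, 1:] * g i)"
    by (rule sum_distrib_left)
  then show ?thesis by simp
qed

lemma remainder_poly_step:
  assumes "degree f \<le> n"
  shows "remainder_poly f n z + smult q f =
         pCons (coeff f 0 * q + carry_sum f n z) (remainder_poly f n (case_nat q z))"
proof -
  let ?z = "case_nat q z"
  \<comment> \<open>The oldest entry may leave the window, since nothing is left of its multiple of
    \<open>f\<close>.\<close>
  have last: "poly_shift (Suc n) f = 0"
    using assms by (intro poly_eqI) (simp add: coeff_poly_shift coeff_eq_0)
  have "pCons 0 (remainder_poly f n ?z) = (\<Sum>i<n. smult (?z i) (pCons 0 (poly_shift (Suc i) f)))"
    by (simp add: remainder_poly_def pCons_0_sum)
  also have "\<dots> = (\<Sum>i<Suc n. smult (?z i) (pCons 0 (poly_shift (Suc i) f)))"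
    by (simp add: last)
  also have "\<dots> = (\<Sum>i<Suc n. smult (?z i) (poly_shift i f - [:coeff f i:]))"
    by (subst (2) poly_shift_unfold) simp
  also have "\<dots> = smult q (f - [:coeff f 0:]) +
      (\<Sum>i<n. smult (z i) (poly_shift (Suc i) f - [:coeff f (Suc i):]))"
    by (subst sum.lessThan_Suc_shift) (simp add: poly_shift_def)
  also have "(\<Sum>i<n. smult (z i) (poly_shift (Suc i) f - [:coeff f (Suc i):])) =
      remainder_poly f n z - [:carry_sum f n z:]"
    by (simp add: remainder_poly_def carry_sum_def smult_diff_right sum_subtractf sum_to_poly mult.commute)
  finally have "pCons 0 (remainder_poly f n ?z) = smult q (f - [:coeff f 0:]) +
      (remainder_poly f n z - [:carry_sum f n z:])" .
  moreover have "pCons (coeff f 0 * q + carry_sum f n z) (remainder_poly f n ?z) =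
      [:coeff f 0 * q + carry_sum f n z:] + pCons 0 (remainder_poly f n ?z)"
    by simp
  ultimately show ?thesis
    by (simp only:) (simp add: smult_diff_right algebra_simps)
qed

lemma terminates_imp_digits:
  assumes "terminates f n z" "degree f \<le> n" "coeff f 0 > 0"
  shows "\<exists>D. (\<forall>i. coeff D i \<in> {0..coeff f 0 - 1}) \<and> f dvd remainder_poly f n z - D"
  using assms(1)
proof induction
  case (halt z)
  then have "remainder_poly f n z = 0"
    by (simp add: remainder_poly_def)
  then show ?case
    using assms(3) by (intro exI[of _ 0]) simp
next
  case (step q z)
  let ?d = "coeff f 0 * q + carry_sum f n z"
  obtain D where D: "\<forall>i. coeff D i \<in> {0..coeff f 0 - 1}"
    "f dvd remainder_poly f n (case_nat q z) - D"
    using step.IH by blast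
  have "remainder_poly f n z - pCons ?d D =
      [:0, 1:] * (remainder_poly f n (case_nat q z) - D) - smult q f"
    using remainder_poly_step[OF assms(2), of z q] by (simp add: algebra_simps)
  then have "f dvd remainder_poly f n z - pCons ?d D"
    by (metis D(2) dvd_diff dvd_mult dvd_refl dvd_smult)
  moreover have "\<forall>i. coeff (pCons ?d D) i \<in> {0..coeff f 0 - 1}"
    using D(1) step.hyps by (auto simp: coeff_pCons split: nat.splits)
  ultimately show ?case by blast
qed

lemma terminates_cong:
  assumes "terminates f n z" "\<And>i. i < n \<Longrightarrow> z i = z' i"
  shows "terminates f n z'"
  using assms
proof (induction arbitrary: z')
  case (halt z)
  then show ?case by (intro terminates.halt) simp
next
  case (step q z)
  have "carry_sum f n z' = carry_sum f n z"
    using step.prems by (simp add: carry_sum_def)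
  moreover have "terminates f n (case_nat q z')"
    using step.prems by (intro step.IH) (auto split: nat.splits)
  ultimately show ?case
    using step.hyps by - (rule terminates.step[of f q n z'], simp_all)
qed

text \<open>Adding \<open>e\<close> to a state changes the carry \<open>q\<close> to some \<open>p\<close>, and the difference \<open>p - q\<close> is an admissible
  carry of \<open>e\<close> itself. So along the orbit of \<open>z\<close> the perturbation never leaves \<open>V\<close>.\<close>

lemma terminates_add:
  assumes "coeff f 0 > 0"
    and closed: "\<And>z q. \<lbrakk>z \<in> V; \<bar>coeff f 0 * q + carry_sum f n z\<bar> < coeff f 0\<rbrakk> \<Longrightarrow> case_nat q z \<in> V"
    and halts: "\<And>z. z \<in> V \<Longrightarrow> terminates f n z"
    and "terminates f n z" "e \<in> V"
  shows "terminates f n (\<lambda>i. z i + e i)"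
  using assms(4,5)
proof (induction arbitrary: e)
  case (halt z)
  then show ?case
    by (intro terminates_cong[OF halts[of e]]) simp_all
next
  case (step q z)
  let ?c = "coeff f 0" and ?s = "carry_sum f n"
  have add: "?s (\<lambda>i. z i + e i) = ?s z + ?s e"
    by (simp add: carry_sum_def algebra_simps sum.distrib)
  define p where "p = - ((?s z + ?s e) div ?c)"
  have "?c * p + (?s z + ?s e) = (?s z + ?s e) mod ?c"
    unfolding p_def by (metis add.commute diff_conv_add_uminus minus_mult_div_eq_mod mult_minus_right)
  then have p: "0 \<le> ?c * p + (?s z + ?s e)" "?c * p + (?s z + ?s e) < ?c"
    using assms(1) by simp_all
  have "?c * (p - q) + ?s e = (?c * p + (?s z + ?s e)) - (?c * q + ?s z)"
    by (simp add: algebra_simps)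
  then have "case_nat (p - q) e \<in> V"
    using p step.hyps(1,2) by (intro closed step.prems) linarith
  then have "terminates f n (\<lambda>i. case_nat q z i + case_nat (p - q) e i)"
    by (rule step.IH)
  moreover have "(\<lambda>i. case_nat q z i + case_nat (p - q) e i) = case_nat p (\<lambda>i. z i + e i)"
    by (auto split: nat.splits)
  ultimately show ?case
    using p by - (rule terminates.step[of f p], simp_all add: add)
qed

text \<open>Adding unit states one at a time to the zero state makes every state with a single
  leading entry terminate. After the first digit \<open>a mod coeff f 0\<close>, the expansion of
  \<open>a\<close> is in such a state.\<close>

lemma witness_set_criterion:
  assumes f: "degree f \<le> n" "n > 0" "coeff f 0 > 0"
    and closed: "\<And>z q. \<lbrakk>z \<in> V; \<bar>coeff f 0 * q + carry_sum f n z\<bar> < coeff f 0\<rbrakk> \<Longrightarrow> case_nat q z \<in> V"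
    and halts: "\<And>z. z \<in> V \<Longrightarrow> terminates f n z"
    and units: "case_nat 1 (\<lambda>_. 0) \<in> V" "case_nat (-1) (\<lambda>_. 0) \<in> V"
  shows "expands_integers f"
  unfolding expands_integers_def
proof
  fix a
  let ?c = "coeff f 0"
  have init: "terminates f n (case_nat q (\<lambda>_. 0))" for q
  proof (induction q rule: int_induct[where k = 0])
    case base
    then show ?case by (intro terminates.halt) (simp split: nat.splits)
  next
    case (step1 q)
    show ?case
      by (rule terminates_cong[OF terminates_add[OF f(3) closed halts step1.IH units(1)]])
        (auto split: nat.splits)
  next
    case (step2 q)
    show ?case
      by (rule terminates_cong[OF terminates_add[OF f(3) closed halts step2.IH units(2)]])
        (auto split: nat.splits)
  qed
  let ?z = "case_nat (- (a div ?c)) (\<lambda>_. 0)"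
  obtain D where D: "\<forall>i. coeff D i \<in> {0..?c - 1}" "f dvd remainder_poly f n ?z - D"
    using terminates_imp_digits[OF init f(1,3)] by blast
  have "smult (- (a div ?c)) f = pCons (?c * - (a div ?c)) (remainder_poly f n ?z)"
    using remainder_poly_step[OF f(1), of "\<lambda>_. 0" "- (a div ?c)"]
    by (simp add: remainder_poly_def carry_sum_def)
  moreover have "a = a mod ?c + ?c * (a div ?c)"
    by simp
  ultimately have "[:a:] - pCons (a mod ?c) D =
      [:0, 1:] * (remainder_poly f n ?z - D) - smult (- (a div ?c)) f"
    by (simp add: minus_mod_eq_mult_div)
  then have "f dvd [:a:] - pCons (a mod ?c) D"
    by (metis D(2) dvd_diff dvd_mult dvd_refl dvd_smult)
  moreover have "\<forall>i. coeff (pCons (a mod ?c) D) i \<in> {0..\<bar>poly f 0\<bar> - 1}"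
    using D(1) f(3) by (auto simp: coeff_pCons poly_0_coeff_0 split: nat.splits)
  ultimately show "\<exists>D. (\<forall>i. coeff D i \<in> {0..\<bar>poly f 0\<bar> - 1}) \<and> f dvd [:a:] - D"
    by blast
qed

section \<open>Decreasing coefficients\<close>

text \<open>The nonzero entries of \<open>z\<close> alternate between \<open>1\<close> and \<open>-1\<close> iff its partial sums
  all lie in \<open>{0, 1}\<close> or all lie in \<open>{-1, 0}\<close>.\<close>

definition partial_sum :: "(nat \<Rightarrow> int) \<Rightarrow> nat \<Rightarrow> int" where
  "partial_sum z j = (\<Sum>i<j. z i)"

lemma partial_sum_0 [simp]: "partial_sum z 0 = 0"
  by (simp add: partial_sum_def)

lemma partial_sum_case_nat [simp]: "partial_sum (case_nat q z) (Suc j) = q + partial_sum z j"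
  unfolding partial_sum_def by (subst sum.lessThan_Suc_shift) simp

lemma all_partial_sum_case_nat:
  "(\<forall>j. partial_sum (case_nat q z) j \<in> S) \<longleftrightarrow> 0 \<in> S \<and> (\<forall>j. q + partial_sum z j \<in> S)"
  by (metis nat.exhaust partial_sum_0 partial_sum_case_nat)

lemma partial_sum_uminus [simp]: "partial_sum (\<lambda>i. - z i) j = - partial_sum z j"
  by (simp add: partial_sum_def sum_negf)

text \<open>Abel summation rewrites the carry sum in partial sums of \<open>z\<close>, with
  nonnegative weights that telescope to \<open>coeff f 1\<close>.\<close>

lemma carry_sum_bounds:
  assumes nonneg: "\<And>i. 0 \<le> coeff f i" and decr: "\<And>i. coeff f (Suc i) \<le> coeff f i"
    and ps: "\<And>j. partial_sum z j \<in> {0, 1}"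
  shows "0 \<le> carry_sum f n z" "carry_sum f n z \<le> coeff f 1"
proof -
  have abel: "carry_sum f n z = coeff f (Suc n) * partial_sum z n +
      (\<Sum>i<n. (coeff f (Suc i) - coeff f (Suc (Suc i))) * partial_sum z (Suc i))"
    by (induction n) (simp_all add: carry_sum_def partial_sum_def algebra_simps)
  have ps': "0 \<le> partial_sum z j" "partial_sum z j \<le> 1" for j
    using ps[of j] by auto
  show "0 \<le> carry_sum f n z"
    unfolding abel using nonneg decr ps'(1) by (intro add_nonneg_nonneg mult_nonneg_nonneg sum_nonneg) auto
  have "carry_sum f n z \<le> coeff f (Suc n) * 1 +
      (\<Sum>i<n. (coeff f (Suc i) - coeff f (Suc (Suc i))) * 1)"
    unfolding abel using nonneg decr ps'(2) by (intro add_mono mult_left_mono sum_mono) auto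
  also have "\<dots> = coeff f 1"
    using sum_lessThan_telescope'[of "\<lambda>i. coeff f (Suc i)" n] by simp
  finally show "carry_sum f n z \<le> coeff f 1" .
qed

text \<open>With \<open>c = coeff f 0\<close>, carry sums lie in \<open>[0, c)\<close> on
  \<open>A\<close>, so only zeros are pushed there; on \<open>B\<close> they lie in
  \<open>(-c, 0]\<close>, and the first nonzero one pushes 1 and leads into
  \<open>A\<close>.\<close>

lemma expands_integers_decreasing:
  assumes nonneg: "\<And>i. 0 \<le> coeff f i" and decr: "\<And>i. coeff f (Suc i) \<le> coeff f i"
    and strict: "coeff f 1 < coeff f 0"
  shows "expands_integers f"
proof -
  \<comment> \<open>The successor keeps the window nonempty even for constant
    \<open>f\<close>.\<close>
  define n where "n = Suc (degree f)"
  define A where "A = {z. \<forall>j. partial_sum z j \<in> {0, 1}}"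
  define B where "B = {z. \<forall>j. partial_sum z j \<in> {-1, 0}}"
  let ?c = "coeff f 0" and ?s = "carry_sum f n"
  have c: "?c > 0" using nonneg[of 1] strict by linarith
  have boundA: "0 \<le> ?s z" "?s z < ?c" if "z \<in> A" for z
    using carry_sum_bounds[OF nonneg decr, of z n] that strict by (auto simp: A_def)
  have boundB: "- ?c < ?s z" "?s z \<le> 0" if "z \<in> B" for z
  proof -
    have "(\<lambda>i. - z i) \<in> A"
      using that by (auto simp: A_def B_def)
    from boundA[OF this] show "- ?c < ?s z" "?s z \<le> 0"
      by (simp_all add: carry_sum_def sum_negf)
  qed
  have shift: "z \<in> A \<Longrightarrow> case_nat 0 z \<in> A" "z \<in> A \<Longrightarrow> case_nat (-1) z \<in> B"
    "z \<in> B \<Longrightarrow> case_nat 0 z \<in> B" "z \<in> B \<Longrightarrow> case_nat 1 z \<in> A" for z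
  proof -
    have "1 + x \<in> {0, 1} \<longleftrightarrow> x \<in> {-1, 0}" "-1 + x \<in> {-1, 0} \<longleftrightarrow> x \<in> {0, 1}" for x :: int
      by auto
    then show "z \<in> A \<Longrightarrow> case_nat 0 z \<in> A" "z \<in> A \<Longrightarrow> case_nat (-1) z \<in> B"
      "z \<in> B \<Longrightarrow> case_nat 0 z \<in> B" "z \<in> B \<Longrightarrow> case_nat 1 z \<in> A"
      by (simp_all only: A_def B_def mem_Collect_eq all_partial_sum_case_nat) simp_all
  qed
  have shift_zeros: "\<forall>i<Suc m. case_nat 0 z i = 0" if "\<forall>i<m. z i = 0" for z :: "nat \<Rightarrow> int" and m
    using that by (auto split: nat.splits)
  \<comment> \<open>\<open>m\<close> counts leading zeros already in the window, \<open>t\<close>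
    bounds the steps until it is all zeros.\<close>
  have termA: "terminates f n z" if "z \<in> A" "\<forall>i<m. z i = 0" "n \<le> m + t" for z m t
    using that
  proof (induction t arbitrary: z m)
    case 0
    then show ?case by (intro terminates.halt) simp
  next
    case (Suc t)
    have "terminates f n (case_nat 0 z)"
      using Suc.prems by (intro Suc.IH[of _ "Suc m"] shift shift_zeros) simp_all
    then show ?case
      using boundA[OF Suc.prems(1)] by - (rule terminates.step[of f 0], simp_all)
  qed
  have termB: "terminates f n z" if "z \<in> B" "\<forall>i<m. z i = 0" "n \<le> m + t" for z m t
    using that
  proof (induction t arbitrary: z m)
    case 0
    then show ?case by (intro terminates.halt) simp
  next
    case (Suc t)
    show ?case
    proof (cases "?s z = 0")
      case True
      have "terminates f n (case_nat 0 z)"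
        using Suc.prems by (intro Suc.IH[of _ "Suc m"] shift shift_zeros) simp_all
      then show ?thesis
        using True c by - (rule terminates.step[of f 0], simp_all)
    next
      case False
      have "terminates f n (case_nat 1 z)"
        using Suc.prems(1) by (intro termA[of _ 0 n] shift) simp_all
      then show ?thesis
        using False boundB[OF Suc.prems(1)] by - (rule terminates.step[of f 1], simp_all)
    qed
  qed
  show ?thesis
  proof (rule witness_set_criterion[where V = "A \<union> B"])
    show "degree f \<le> n" "n > 0" "?c > 0"
      using c by (simp_all add: n_def)
    show "terminates f n z" if "z \<in> A \<union> B" for z
      using that termA[of z 0 n] termB[of z 0 n] by auto
    have "(\<lambda>_. 0) \<in> A" "(\<lambda>_. 0) \<in> B"
      by (simp_all add: A_def B_def partial_sum_def)
    then show "case_nat 1 (\<lambda>_. 0) \<in> A \<union> B" "case_nat (- 1) (\<lambda>_. 0) \<in> A \<union> B"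
      using shift(2,4) by blast+
    show "case_nat q z \<in> A \<union> B" if z: "z \<in> A \<union> B" and q: "\<bar>?c * q + ?s z\<bar> < ?c" for z q
    proof (cases "z \<in> A")
      case True
      have "?c * (-2) < ?c * q" "?c * q < ?c * 1"
        using q boundA[OF True] by linarith+
      then have "q = 0 \<or> q = -1"
        using c by (simp only: mult_less_cancel_left_pos) linarith
      then show ?thesis using shift(1,2)[OF True] by blast
    next
      case False
      then have "z \<in> B" using z by blast
      have "?c * (-1) < ?c * q" "?c * q < ?c * 2"
        using q boundB[OF \<open>z \<in> B\<close>] by linarith+
      then have "q = 0 \<or> q = 1"
        using c by (simp only: mult_less_cancel_left_pos) linarith
      then show ?thesis using shift(3,4)[OF \<open>z \<in> B\<close>] by blast
    qed
  qed
qed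

section \<open>A cone of quartics\<close>

text \<open>The rays, constant coefficient first, are obtained from the coefficients
  \<open>6 P\<close>, \<open>5 P + 6 S\<close>, \<open>P + 5 S + 6 U\<close>, \<open>S + 5 U\<close>, \<open>U\<close> of \<open>(t + 2) (t + 3) (U t\<^sup>2 + S t + P)\<close> for
  \<open>(P, S, U) = (6, 1, 0), (72, 12, 1), (35, 12, 1), (5, 1, 0)\<close>.\<close>

definition cone_rays :: "int list list" where
  "cone_rays = [[36, 36, 11, 1, 0], [432, 432, 138, 17, 1], [210, 247, 101, 17, 1], [30, 31, 10, 1, 0]]"

definition ray_carry_sum :: "int list \<Rightarrow> int list \<Rightarrow> int" where
  "ray_carry_sum g w = sum_list (map2 (*) (tl g) w)"

text \<open>All \<open>q\<close> which for some polynomial in the cone can follow the window \<open>w\<close>: as the carry of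
  the recursion for \<open>t = 0\<close>, as an admissible carry in the closure condition for \<open>t = 1\<close>.\<close>

definition carries :: "int \<Rightarrow> int list \<Rightarrow> int list" where
  "carries t w =
     [Min (set (map (\<lambda>g. - ((ray_carry_sum g w - t * (1 - hd g)) div hd g)) cone_rays)) ..
      Max (set (map (\<lambda>g. (hd g - 1 - ray_carry_sum g w) div hd g) cone_rays))]"

text \<open>The closure of the two unit vectors under \<open>carries 1\<close>, sorted by decreasing length of the longest
  orbit under \<open>carries 0\<close>.\<close>

definition cone_witnesses :: "int list list" where
  "cone_witnesses =
    [[-2, 1, 0, -1], [-2, 1, 0, 0], [-2, 2, -2, 1], [-2, 2, -2, 2], [-2, 2, -1, 0],
     [-1, 0, 0, 0], [-1, 0, 0, 1], [-1, 0, 1, -2], [-1, 0, 1, -1], [-1, 0, 1, 0],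
     [0, -1, 0, 0], [0, -1, 0, 1], [0, -1, 1, -2], [0, -1, 1, -1], [0, -1, 1, 0],
     [0, -1, 2, -2], [0, -1, 2, -1], [0, 0, -1, 0], [0, 0, -1, 1], [0, 0, -1, 2],
     [0, 0, 0, -1], [1, 0, -1, 0], [1, 0, -1, 1], [1, 0, -1, 2], [1, 0, 0, -1],
     [1, 0, 0, 0], [2, -2, 1, 0], [2, -2, 2, -2], [2, -2, 2, -1], [2, -1, 0, 0],
     [2, -1, 0, 1], [-1, 1, -2, 1], [-1, 1, -2, 2], [-1, 1, -1, 0], [-1, 1, -1, 1],
     [-1, 1, -1, 2], [-1, 1, 0, -1], [-1, 1, 0, 0], [-1, 2, -2, 1], [-1, 2, -2, 2],
     [-1, 2, -1, 0], [1, -2, 1, 0], [1, -2, 2, -2], [1, -2, 2, -1], [1, -1, 0, 0],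
     [1, -1, 0, 1], [1, -1, 1, -2], [1, -1, 1, -1], [1, -1, 1, 0], [1, -1, 2, -2],
     [1, -1, 2, -1], [0, 1, -2, 1], [0, 1, -2, 2], [0, 1, -1, 0], [0, 1, -1, 1],
     [0, 1, -1, 2], [0, 1, 0, -1], [0, 1, 0, 0], [0, 0, 1, -2], [0, 0, 1, -1],
     [0, 0, 1, 0], [0, 0, 0, 1], [0, 0, 0, 0]]"

lemma length_cone_witnesses: "length cone_witnesses = 63"
  by (simp add: cone_witnesses_def)

lemma cone_witnesses_closed:
  "\<forall>w\<in>set cone_witnesses. \<forall>q\<in>set (carries 1 w). q # butlast w \<in> set cone_witnesses"
  by code_simp

text \<open>Every possible successor stands later in the list, so the position is a termination
  measure valid for the whole cone at once.\<close>

lemma cone_witnesses_descending: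
  "\<forall>i\<in>set [0..<63]. cone_witnesses ! i = [0, 0, 0, 0] \<or>
     (\<forall>q\<in>set (carries 0 (cone_witnesses ! i)).
        q # butlast (cone_witnesses ! i) \<in> set (drop (Suc i) cone_witnesses))"
  by code_simp

text \<open>Passes a strict linear inequality from a polynomial of the cone to at least one
  ray.\<close>

lemma nonneg_combination_pos:
  fixes \<alpha> y :: "nat \<Rightarrow> int"
  assumes "\<And>j. 0 \<le> \<alpha> j" "0 < (\<Sum>j<n. \<alpha> j * y j)"
  shows "\<exists>j<n. 0 < y j"
proof (rule ccontr)
  assume "\<not> (\<exists>j<n. 0 < y j)"
  then have "y j \<le> 0" if "j < n" for j
    using that by (meson not_less)
  then have "(\<Sum>j<n. \<alpha> j * y j) \<le> 0"
    using assms(1) by (intro sum_nonpos mult_nonneg_nonpos) auto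
  then show False using assms(2) by simp
qed

lemma length_cone_rays: "length cone_rays = 4"
  by (simp add: cone_rays_def)

lemma cone_rays_hd: "j < 4 \<Longrightarrow> 0 < hd (cone_rays ! j) \<and> hd (cone_rays ! j) \<le> 432"
  by (auto simp: cone_rays_def less_Suc_eq numeral_eq_Suc)

text \<open>The two bounds on \<open>q\<close> may come from different rays, hence the separate
  minimum and maximum in \<open>carries\<close>.\<close>

lemma carriesI:
  assumes "i < 4" "t * (1 - hd (cone_rays ! i)) \<le> hd (cone_rays ! i) * q + ray_carry_sum (cone_rays ! i) w"
    and "j < 4" "hd (cone_rays ! j) * q + ray_carry_sum (cone_rays ! j) w < hd (cone_rays ! j)"
  shows "q \<in> set (carries t w)"
proof -
  have mem: "cone_rays ! i \<in> set cone_rays" "cone_rays ! j \<in> set cone_rays"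
    using assms(1,3) nth_mem[of _ cone_rays] by (simp_all add: length_cone_rays)
  have "- q = (hd (cone_rays ! i) * (- q)) div hd (cone_rays ! i)"
    using cone_rays_hd[OF assms(1)] by (subst nonzero_mult_div_cancel_left) auto
  also have "\<dots> \<le> (ray_carry_sum (cone_rays ! i) w - t * (1 - hd (cone_rays ! i))) div hd (cone_rays ! i)"
    using cone_rays_hd[OF assms(1)] assms(2) by (intro zdiv_mono1) auto
  finally have lo: "- ((ray_carry_sum (cone_rays ! i) w - t * (1 - hd (cone_rays ! i))) div hd (cone_rays ! i)) \<le> q"
    by simp
  have "q = (hd (cone_rays ! j) * q) div hd (cone_rays ! j)"
    using cone_rays_hd[OF assms(3)] by simp
  also have "\<dots> \<le> (hd (cone_rays ! j) - 1 - ray_carry_sum (cone_rays ! j) w) div hd (cone_rays ! j)"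
    using cone_rays_hd[OF assms(3)] assms(4) by (intro zdiv_mono1) auto
  finally have hi: "q \<le> (hd (cone_rays ! j) - 1 - ray_carry_sum (cone_rays ! j) w) div hd (cone_rays ! j)" .
  show ?thesis
    unfolding carries_def set_upto atLeastAtMost_iff set_map
    using mem by (intro conjI order.trans[OF Min_le lo] order.trans[OF hi Max_ge]) auto
qed

lemma map_case_nat_window: "map (case_nat q z) [0..<4] = q # butlast (map z [0..<4])"
  by (simp add: upt_rec)

text \<open>\<open>K\<close> is a common denominator for the cone coordinates. Conditions on a carry
  are positivity statements linear in the coefficients of \<open>f\<close>, so each is inherited by
  some ray and the computed facts about \<open>carries\<close> apply.\<close>

lemma expands_integers_cone:
  fixes \<alpha> :: "nat \<Rightarrow> int"
  assumes deg: "degree f \<le> 4" and c: "0 < coeff f 0"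
    and K: "0 < K" and \<alpha>: "\<And>j. 0 \<le> \<alpha> j"
    and comb: "\<And>i. i \<le> 4 \<Longrightarrow> K * coeff f i = (\<Sum>j<4. \<alpha> j * cone_rays ! j ! i)"
  shows "expands_integers f"
proof -
  let ?c = "coeff f 0" and ?s = "carry_sum f 4" and ?w = "\<lambda>z. map z [0..<4]"
  let ?h = "\<lambda>j. hd (cone_rays ! j)" and ?r = "\<lambda>j. ray_carry_sum (cone_rays ! j)"
  have head: "K * ?c = (\<Sum>j<4. \<alpha> j * ?h j)"
    using comb[of 0] by (simp add: cone_rays_def numeral_eq_Suc)
  have tail: "K * ?s z = (\<Sum>j<4. \<alpha> j * ?r j (?w z))" for z
  proof -
    have "K * ?s z = (\<Sum>i<4. (K * coeff f (Suc i)) * z i)"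
      by (simp add: carry_sum_def sum_distrib_left mult.assoc)
    also have "\<dots> = (\<Sum>i<4. (\<Sum>j<4. \<alpha> j * cone_rays ! j ! Suc i) * z i)"
      by (intro sum.cong) (simp_all add: comb)
    also have "\<dots> = (\<Sum>j<4. \<alpha> j * ?r j (?w z))"
      by (simp add: cone_rays_def ray_carry_sum_def numeral_eq_Suc algebra_simps)
    finally show ?thesis .
  qed
  have comb': "K * (x * ?c + y * ?s z) = (\<Sum>j<4. \<alpha> j * (x * ?h j + y * ?r j (?w z)))" for x y z
  proof -
    have "K * (x * ?c + y * ?s z) = x * (K * ?c) + y * (K * ?s z)"
      by (simp add: algebra_simps)
    also have "\<dots> = (\<Sum>j<4. \<alpha> j * (x * ?h j + y * ?r j (?w z)))"
      unfolding head tail by (simp add: sum_distrib_left algebra_simps flip: sum.distrib)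
    finally show ?thesis .
  qed
  have ex_ray: "\<exists>j<4. 0 < x * ?h j + y * ?r j (?w z)" if "0 < x * ?c + y * ?s z" for x y z
    using that K by (intro nonneg_combination_pos[of \<alpha>, OF \<alpha>]) (simp flip: comb')
  have upper: "\<exists>j<4. ?h j * q + ?r j (?w z) < ?h j" if "?c * q + ?s z < ?c" for q z
    using ex_ray[of "1 - q" "-1" z] that by (auto simp: algebra_simps)
  have closed: "case_nat q z \<in> {z. ?w z \<in> set cone_witnesses}"
    if z: "z \<in> {z. ?w z \<in> set cone_witnesses}" and q: "\<bar>?c * q + ?s z\<bar> < ?c" for z q
  proof -
    have "0 < (q + 1) * ?c + 1 * ?s z"
      using q by (simp add: algebra_simps abs_less_iff)
    then obtain i where "i < 4" "0 < (q + 1) * ?h i + 1 * ?r i (?w z)"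
      using ex_ray by blast
    then have "i < 4" "1 * (1 - ?h i) \<le> ?h i * q + ?r i (?w z)"
      by (simp_all add: algebra_simps)
    moreover obtain j where "j < 4" "?h j * q + ?r j (?w z) < ?h j"
      using upper[OF le_less_trans[OF abs_ge_self q]] by blast
    ultimately have "q \<in> set (carries 1 (?w z))"
      by (rule carriesI)
    then show ?thesis
      using z cone_witnesses_closed by (simp only: mem_Collect_eq map_case_nat_window)
  qed
  \<comment> \<open>Downward induction on the start of a suffix of the list; at 63 the suffix is
    empty.\<close>
  have "\<forall>z. ?w z \<in> set (drop n cone_witnesses) \<longrightarrow> terminates f 4 z" if "n \<le> 63" for n
    using that
  proof (induction rule: inc_induct)
    case base
    show ?case
      by (simp add: length_cone_witnesses)
  next
    case (step n)
    note n = step.hyps(2) and IH = step.IH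
    have "n < length cone_witnesses"
      using n by (simp add: length_cone_witnesses)
    then have drop: "drop n cone_witnesses = cone_witnesses ! n # drop (Suc n) cone_witnesses"
      by (rule Cons_nth_drop_Suc[symmetric])
    have "terminates f 4 z" if z: "?w z = cone_witnesses ! n" for z
    proof (cases "?w z = [0, 0, 0, 0]")
      case True
      then have "z i = 0" if "i < 4" for i
        using that by (auto simp: upt_rec less_Suc_eq numeral_eq_Suc)
      then show ?thesis by (rule terminates.halt)
    next
      case False
      define q where "q = - (?s z div ?c)"
      have "?c * q + ?s z = ?s z mod ?c"
        by (simp add: q_def minus_mult_div_eq_mod[symmetric])
      then have q: "0 \<le> ?c * q + ?s z" "?c * q + ?s z < ?c"
        using c by simp_all
      txt \<open>The factor 432 turns the weak inequality \<open>q(1)\<close> into a strict one without losing it on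
        the rays, where the constant coefficients are at most 432.\<close>
      have "0 < (432 * q + 1) * ?c + 432 * ?s z"
        using q c by (simp add: algebra_simps)
      then obtain i where i: "i < 4" "0 < (432 * q + 1) * ?h i + 432 * ?r i (?w z)"
        using ex_ray by blast
      then have "0 * (1 - ?h i) \<le> ?h i * q + ?r i (?w z)"
        using cone_rays_hd[OF i(1)] by (simp add: algebra_simps)
      moreover obtain j where "j < 4" "?h j * q + ?r j (?w z) < ?h j"
        using upper[OF q(2)] by auto
      ultimately have "q \<in> set (carries 0 (?w z))"
        using i(1) by (intro carriesI)
      then have "?w (case_nat q z) \<in> set (drop (Suc n) cone_witnesses)"
        using cone_witnesses_descending n z False unfolding map_case_nat_window by auto
      then show ?thesis
        using IH q by - (rule terminates.step[of f q], simp_all)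
    qed
    then show ?case
      unfolding drop using IH by auto
  qed
  from this[of 0] have "terminates f 4 z" if "z \<in> {z. ?w z \<in> set cone_witnesses}" for z
    using that by simp
  then show ?thesis
    by (intro witness_set_criterion[OF deg _ c closed])
      (simp_all add: map_case_nat_window, simp_all add: upt_rec cone_witnesses_def)
qed

text \<open>The cubic is itself the last ray, read as a quartic with leading coefficient 0.\<close>

lemma expands_integers_2_3_5: "expands_integers ([:2, 1:] * [:3, 1:] * [:5, 1:])"
  by (rule expands_integers_cone[where K = 1 and \<alpha> = "\<lambda>j. if j = 3 then 1 else 0"])
    (auto simp: cone_rays_def le_Suc_eq numeral_eq_Suc)

lemma quartic_2_3:
  fixes x y :: int
  shows "[:2, 1:] * [:3, 1:] * [:x, 1:] * [:y, 1:] =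
    [:6 * (x * y), 5 * (x * y) + 6 * (x + y), x * y + 5 * (x + y) + 6, x + y + 5, 1:]"
  by (simp add: algebra_simps)

text \<open>Here \<open>(P, S, U) = (5 y, y + 5, 1) = (35, 12, 1) + (y - 7) (5, 1,
  0)\<close>.\<close>

lemma expands_integers_2_3_5_y:
  fixes y :: int
  assumes "7 \<le> y"
  shows "expands_integers ([:2, 1:] * [:3, 1:] * [:5, 1:] * [:y, 1:])"
  unfolding quartic_2_3 using assms
  by (intro expands_integers_cone[where K = 1 and \<alpha> = "\<lambda>j. if j = 2 then 1 else if j = 3 then y - 7 else 0"])
    (auto simp: cone_rays_def le_Suc_eq numeral_eq_Suc)

text \<open>The weights solve the linear system expressing \<open>(x y, x + y, 1)\<close> in the
  first three rays; its determinant is 37 up to sign. The second weight is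
  \<open>(x - 6) (y - 6) + 1\<close>.\<close>

lemma expands_integers_2_3_x_y:
  fixes x y :: int
  assumes "6 \<le> x" "6 \<le> y" "x * y \<le> 6 * (x + y)"
  shows "expands_integers ([:2, 1:] * [:3, 1:] * [:x, 1:] * [:y, 1:])"
proof -
  have "0 \<le> (x - 6) * (y - 6)" "0 < x * y"
    using assms by simp_all
  then show ?thesis
    unfolding quartic_2_3 using assms
    by (intro expands_integers_cone[where K = 37 and
          \<alpha> = "(\<lambda>j. 0)(0 := 37 * (x + y - 12), 1 := 37 - 6 * (x + y) + x * y, 2 := 6 * (x + y) - x * y)"])
      (auto simp: cone_rays_def le_Suc_eq numeral_eq_Suc algebra_simps)
qed

lemma coeff_linear_mult:
  "coeff ([:m, 1:] * f) i = m * coeff f i + (case i of 0 \<Rightarrow> 0 | Suc j \<Rightarrow> coeff f j)"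
  for f :: "'a::comm_semiring_1 poly"
  by (simp add: coeff_pCons)

section \<open>Products of linear factors\<close>

text \<open>The third claim is the logarithmic derivative of the product at 0.\<close>

lemma prod_linear_coeffs:
  fixes A :: "int set"
  assumes "finite A" "\<forall>m\<in>A. 0 < m"
  shows "0 \<le> coeff (\<Prod>m\<in>A. [:m, 1:]) i" "0 < coeff (\<Prod>m\<in>A. [:m, 1:]) 0"
    "real_of_int (coeff (\<Prod>m\<in>A. [:m, 1:]) 1) =
       real_of_int (coeff (\<Prod>m\<in>A. [:m, 1:]) 0) * (\<Sum>m\<in>A. 1 / real_of_int m)"
  using assms
proof (induction arbitrary: i)
  case empty
  {
    case 1 show ?case by simp
  next
    case 2 show ?case by simp
  next
    case 3 show ?case by simp
  }
next
  case (insert m A)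
  {
    case 1
    then show ?case
      using insert.hyps insert.IH(1) by (auto simp: coeff_linear_mult simp del: mult_pCons_left split: nat.splits)
  next
    case 2
    then show ?case
      using insert.hyps insert.IH(2) by (simp add: coeff_linear_mult del: mult_pCons_left)
  next
    case 3
    then have "real_of_int m \<noteq> 0"
      by auto
    moreover have "(\<Prod>m\<in>insert m A. [:m, 1:]) = [:m, 1:] * (\<Prod>m\<in>A. [:m, 1:])"
      using insert.hyps by simp
    ultimately show ?case
      using 3 insert.hyps insert.IH(3) by (simp add: coeff_linear_mult distrib_left del: mult_pCons_left)
  }
qed

text \<open>A further factor \<open>t + m\<close> preserves the decrease at positive indices; at
  index 0 the ratio of the two coefficients is the reciprocal sum.\<close>

lemma prod_linear_coeffs_decreasing:
  fixes A :: "int set"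
  assumes "finite A" "\<forall>m\<in>A. 0 < m" "(\<Sum>m\<in>A. 1 / real_of_int m) < 1"
  shows "coeff (\<Prod>m\<in>A. [:m, 1:]) (Suc i) \<le> coeff (\<Prod>m\<in>A. [:m, 1:]) i"
  using assms
proof (induction arbitrary: i)
  case empty
  then show ?case by simp
next
  case (insert m A)
  show ?case
  proof (cases i)
    case 0
    let ?f = "\<Prod>m\<in>insert m A. [:m, 1:]"
    have "real_of_int (coeff ?f 1) \<le> real_of_int (coeff ?f 0) * 1"
      unfolding prod_linear_coeffs(3)[OF finite.insertI[OF insert.hyps(1)] insert.prems(1)]
      using insert.prems prod_linear_coeffs(2)[of "insert m A"] insert.hyps(1)
      by (intro mult_left_mono) auto
    then show ?thesis using 0 by simp
  next
    case (Suc j)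
    have "0 < 1 / real_of_int m"
      using insert.prems(1) by simp
    moreover have "1 / real_of_int m + (\<Sum>m\<in>A. 1 / real_of_int m) < 1"
      using insert.prems(2) insert.hyps by simp
    ultimately have "(\<Sum>m\<in>A. 1 / real_of_int m) < 1"
      by linarith
    then have IH: "coeff (\<Prod>m\<in>A. [:m, 1:]) (Suc i) \<le> coeff (\<Prod>m\<in>A. [:m, 1:]) i" for i
      using insert.IH insert.prems(1) by blast
    have "m * coeff (\<Prod>m\<in>A. [:m, 1:]) (Suc (Suc j)) \<le> m * coeff (\<Prod>m\<in>A. [:m, 1:]) (Suc j)"
      using insert.prems(1) IH by (intro mult_left_mono) auto
    then show ?thesis
      using IH[of j] insert.hyps by (simp add: Suc coeff_linear_mult del: mult_pCons_left)
  qed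
qed

lemma expands_integers_reciprocals:
  fixes A :: "int set"
  assumes "finite A" "\<forall>m\<in>A. 0 < m" "(\<Sum>m\<in>A. 1 / real_of_int m) < 1"
  shows "expands_integers (\<Prod>m\<in>A. [:m, 1:])"
proof (rule expands_integers_decreasing)
  let ?f = "\<Prod>m\<in>A. [:m, 1:]"
  have "real_of_int (coeff ?f 1) < real_of_int (coeff ?f 0) * 1"
    unfolding prod_linear_coeffs(3)[OF assms(1,2)]
    using assms(3) prod_linear_coeffs(2)[OF assms(1,2)] by (intro mult_strict_left_mono) auto
  then show "coeff ?f 1 < coeff ?f 0" by simp
qed (use assms prod_linear_coeffs(1) prod_linear_coeffs_decreasing in blast)+

section \<open>At most four pairwise coprime factors\<close>

lemma expands_integers_3:
  fixes a b c :: int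
  assumes "2 \<le> a" "a < b" "b < c" "coprime a b" "coprime a c"
  shows "expands_integers (\<Prod>m\<in>{a, b, c}. [:m, 1:])"
proof (cases "(\<Sum>m\<in>{a, b, c}. 1 / real_of_int m) < 1")
  case True
  then show ?thesis
    using assms by (intro expands_integers_reciprocals) auto
next
  case False
  then have sum: "1 / real_of_int a + 1 / real_of_int b + 1 / real_of_int c \<ge> 1"
    using assms by simp
  have "a = 2"
  proof (rule ccontr)
    assume "a \<noteq> 2"
    then have "3 \<le> a" "4 \<le> b" "5 \<le> c"
      using assms by linarith+
    then have "1 / real_of_int a \<le> 1 / 3" "1 / real_of_int b \<le> 1 / 4" "1 / real_of_int c \<le> 1 / 5"
      by simp_all
    then show False
      using sum by linarith
  qed
  \<comment> \<open>Coprimality to 2 pushes the remaining entries up to odd numbers, which makes the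
    reciprocal bounds below small enough.\<close>
  then have odd: "odd b" "odd c"
    using assms by (auto simp: coprime_left_2_iff_odd)
  have "b = 3"
  proof (rule ccontr)
    assume "b \<noteq> 3"
    then have "5 \<le> b" "7 \<le> c"
      using assms(1-3) odd \<open>a = 2\<close> by presburger+
    then have "1 / real_of_int b \<le> 1 / 5" "1 / real_of_int c \<le> 1 / 7"
      by simp_all
    then show False
      using sum unfolding \<open>a = 2\<close> by linarith
  qed
  have "c = 5"
  proof (rule ccontr)
    assume "c \<noteq> 5"
    then have "7 \<le> c"
      using assms(3) odd \<open>b = 3\<close> by presburger
    then have "1 / real_of_int c \<le> 1 / 7"
      by simp
    then show False
      using sum unfolding \<open>a = 2\<close> \<open>b = 3\<close> by linarith
  qed
  then show ?thesis
    using expands_integers_2_3_5 \<open>a = 2\<close> \<open>b = 3\<close> by (simp add: mult.assoc del: mult_pCons_left mult_pCons_right)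
qed

lemma expands_integers_4:
  fixes a b c d :: int
  assumes "2 \<le> a" "a < b" "b < c" "c < d" "coprime a b" "coprime a c" "coprime a d"
  shows "expands_integers (\<Prod>m\<in>{a, b, c, d}. [:m, 1:])"
proof (cases "(\<Sum>m\<in>{a, b, c, d}. 1 / real_of_int m) < 1")
  case True
  then show ?thesis
    using assms by (intro expands_integers_reciprocals) auto
next
  case False
  then have sum: "1 / real_of_int a + 1 / real_of_int b + 1 / real_of_int c + 1 / real_of_int d \<ge> 1"
    using assms by simp
  have "a = 2"
  proof (rule ccontr)
    assume "a \<noteq> 2"
    then have "3 \<le> a" "4 \<le> b" "5 \<le> c" "6 \<le> d"
      using assms by linarith+
    then have "1 / real_of_int a \<le> 1 / 3" "1 / real_of_int b \<le> 1 / 4"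
      "1 / real_of_int c \<le> 1 / 5" "1 / real_of_int d \<le> 1 / 6"
      by simp_all
    then show False
      using sum by linarith
  qed
  then have odd: "odd b" "odd c" "odd d"
    using assms by (auto simp: coprime_left_2_iff_odd)
  have "b = 3"
  proof (rule ccontr)
    assume "b \<noteq> 3"
    then have "5 \<le> b" "7 \<le> c" "9 \<le> d"
      using assms(1-4) odd \<open>a = 2\<close> by presburger+
    then have "1 / real_of_int b \<le> 1 / 5" "1 / real_of_int c \<le> 1 / 7" "1 / real_of_int d \<le> 1 / 9"
      by simp_all
    then show False
      using sum unfolding \<open>a = 2\<close> by linarith
  qed
  have prod: "(\<Prod>m\<in>{a, b, c, d}. [:m, 1:]) = [:2, 1:] * [:3, 1:] * [:c, 1:] * [:d, 1:]"
    using assms \<open>a = 2\<close> \<open>b = 3\<close> by (simp add: mult.assoc del: mult_pCons_left mult_pCons_right)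
  have "5 \<le> c" "7 \<le> d"
    using assms(3,4) odd \<open>b = 3\<close> by presburger+
  show ?thesis
  proof (cases "c = 5")
    case True
    then show ?thesis
      unfolding prod using expands_integers_2_3_5_y[OF \<open>7 \<le> d\<close>] by simp
  next
    case False
    \<comment> \<open>What 1/2 and 1/3 leave of 1; clearing denominators gives the hypothesis of
      \<open>expands_integers_2_3_x_y\<close>.\<close>
    have "1 / 6 \<le> 1 / real_of_int c + 1 / real_of_int d"
      using sum \<open>a = 2\<close> \<open>b = 3\<close> by simp
    then have "real_of_int (c * d) \<le> real_of_int (6 * (c + d))"
      using \<open>5 \<le> c\<close> \<open>7 \<le> d\<close> by (simp add: field_simps)
    then have "c * d \<le> 6 * (c + d)"
      by (simp only: of_int_le_iff)
    then show ?thesis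
      unfolding prod using \<open>5 \<le> c\<close> \<open>7 \<le> d\<close> False by (intro expands_integers_2_3_x_y) auto
  qed
qed

lemma expands_integers_card_le_4:
  fixes A :: "int set"
  assumes A: "finite A" "card A \<le> 4" "\<forall>m\<in>A. 2 \<le> m"
    and coprime: "\<forall>m\<in>A. \<forall>n\<in>A. m \<noteq> n \<longrightarrow> coprime m n"
  shows "expands_integers (\<Prod>m\<in>A. [:m, 1:])"
proof -
  obtain xs where xs: "sorted_wrt (<) xs" "set xs = A" "length xs = card A"
    using A(1) by (metis sorted_list_of_set.length_sorted_key_list_of_set
        sorted_list_of_set.set_sorted_key_list_of_set strict_sorted_list_of_set)
  have pos: "\<forall>m\<in>A. 0 < m"
    using A(3) by auto
  have "length xs \<in> {0, 1, 2, 3, 4}"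
    using xs(3) A(2) by auto
  then consider "xs = []" | a where "xs = [a]" | a b where "xs = [a, b]"
    | a b c where "xs = [a, b, c]" | a b c d where "xs = [a, b, c, d]"
    by (auto simp: numeral_eq_Suc length_Suc_conv)
  then show ?thesis
  proof cases
    case 1
    then have "A = {}" using xs by simp
    then show ?thesis
      using expands_integers_reciprocals[of "{}"] by simp
  next
    case 2
    then have "A = {a}" using xs by simp
    then have "(\<Sum>m\<in>A. 1 / real_of_int m) < 1"
      using A(3) by simp
    then show ?thesis
      by (rule expands_integers_reciprocals[OF A(1) pos])
  next
    case 3
    then have "A = {a, b}" "a < b" using xs by auto
    moreover have "2 \<le> a" "3 \<le> b"
      using calculation A(3) by auto
    ultimately have "1 / real_of_int a \<le> 1 / 2" "1 / real_of_int b \<le> 1 / 3"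
      by simp_all
    then have "1 / real_of_int a + 1 / real_of_int b < 1"
      by linarith
    then have "(\<Sum>m\<in>A. 1 / real_of_int m) < 1"
      using \<open>A = {a, b}\<close> \<open>a < b\<close> by simp
    then show ?thesis
      by (rule expands_integers_reciprocals[OF A(1) pos])
  next
    case 4
    then have "A = {a, b, c}" "a < b" "b < c" using xs by auto
    then show ?thesis
      using A(3) coprime expands_integers_3[of a b c] by auto
  next
    case 5
    then have "A = {a, b, c, d}" "a < b" "b < c" "c < d" using xs by auto
    then show ?thesis
      using A(3) coprime expands_integers_4[of a b c d] by auto
  qed
qed

theorem theorem4p6:
  fixes k :: nat and N :: "nat \<Rightarrow> int"
  assumes "\<forall>i\<in>{1..k}. \<forall>j\<in>{1..k}. i \<noteq> j \<longrightarrow> coprime (N i) (N j)"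
    and "\<forall>j\<in>{1..k}. N j \<le> -2"
  shows "(CNS_polynomial (\<Prod>j=1..k. [:- N j, 1:]) \<longrightarrow>
            (\<forall>a::int. has_simultaneous_expansion k N a)) \<and>
         (k \<le> 4 \<longrightarrow> (\<forall>a::int. has_simultaneous_expansion k N a))"
proof (intro conjI impI allI)
  fix a
  assume CNS: "CNS_polynomial (\<Prod>j=1..k. [:- N j, 1:])"
  have "poly (\<Prod>j=1..k. [:- N j, 1:]) 0 \<noteq> 0"
    using assms(2) by (auto simp: poly_prod)
  then show "has_simultaneous_expansion k N a"
    using expands_integers_imp_expansion CNS_imp_expands_integers[OF CNS] by blast
next
  fix a
  assume k: "k \<le> 4"
  let ?M = "\<lambda>j. - N j"
  \<comment> \<open>No integer \<open>\<le> -2\<close> is coprime to itself, so the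
    \<open>N j\<close> are distinct and the indexed product is a product over a set.\<close>
  have inj: "inj_on ?M {1..k}"
  proof (rule inj_onI)
    fix i j
    assume ij: "i \<in> {1..k}" "j \<in> {1..k}" "?M i = ?M j"
    have "\<not> coprime (N i) (N i)"
      using assms(2) ij(1) by fastforce
    then show "i = j"
      using assms(1) ij by force
  qed
  have "expands_integers (\<Prod>m\<in>?M ` {1..k}. [:m, 1:])"
  proof (rule expands_integers_card_le_4)
    show "card (?M ` {1..k}) \<le> 4"
      using k inj by (simp add: card_image)
    show "\<forall>m\<in>?M ` {1..k}. 2 \<le> m"
      using assms(2) by fastforce
    show "\<forall>m\<in>?M ` {1..k}. \<forall>n\<in>?M ` {1..k}. m \<noteq> n \<longrightarrow> coprime m n"
      using assms(1) by auto
  qed simp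
  also have "(\<Prod>m\<in>?M ` {1..k}. [:m, 1:]) = (\<Prod>j=1..k. [:- N j, 1:])"
    using inj by (simp add: prod.reindex)
  finally show "has_simultaneous_expansion k N a"
    by (rule expands_integers_imp_expansion)
qed

end
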